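(* Let $m,n,d_x,d_y$ be positive integers with $2m\le\min(d_x,d_y)$, let $\mathbf X\in\mathbb R^{n\times d_x}$ and $\mathbf Y\in\mathbb R^{n\times d_y}$, and let $\mathbf A\in\mathbb R^{2m\times d_x}$, $\mathbf B\in\mathbb R^{2m\times d_y}$ be the output of the Co-Occurring Directions algorithm (COD) run on $\mathbf X,\mathbf Y$ with sketch size $m$. Then for every integer $k$ with $0\le k<m$, $$\|\mathbf X^\top\mathbf Y-\mathbf A^\top\mathbf B\|_2\le\frac1{m-k}\Big(\|\mathbf X\|_F\|\mathbf Y\|_F-\|\mathbf X^\top\mathbf Y\|_k\Big).$$
   Context: For a real matrix $\mathbf M$, $\sigma_1(\mathbf M)\ge\sigma_2(\mathbf M)\ge\cdots$ are its singular values (with $\sigma_i(\mathbf M)=0$ for $i>\operatorname{rank}\mathbf M$), $\|\mathbf M\|_2=\sigma_1(\mathbf M)$ is the spectral norm, $\|\mathbf M\|_F$ the Frobenius norm, and $\|\mathbf M\|_k=\sum_{i=1}^k\sigma_i(\mathbf M)$ the Ky Fan $k$-norm (so $\|\mathbf M\|_0=0$ when $k=0$). COD algorithm. Input: $\mathbf X\in\mathbb R^{n\times d_x}$, $\mathbf Y\in\mathbb R^{n\times d_y}$ with $t$-th rows $(\mathbf x^{(t)})^\top$, $(\mathbf y^{(t)})^\top$, and sketch size $m$. Initialize $\mathbf A=\mathbf 0_{2m\times d_x}$, $\mathbf B=\mathbf 0_{2m\times d_y}$, with all $2m$ row positions unoccupied. For $t=1,\dots,n$: (1) Choose an unoccupied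 row position $j$, set the $j$-th row of $\mathbf A$ to $(\mathbf x^{(t)})^\top$ and the $j$-th row of $\mathbf B$ to $(\mathbf y^{(t)})^\top$; position $j$ is now occupied. (2) If all $2m$ positions are occupied, then: compute reduced QR factorizations $\mathbf A^\top=\mathbf Q_x\mathbf R_x$ and $\mathbf B^\top=\mathbf Q_y\mathbf R_y$ (where $\mathbf Q_x\in\mathbb R^{d_x\times 2m}$, $\mathbf Q_y\in\mathbb R^{d_y\times 2m}$ have orthonormal columns and $\mathbf R_x,\mathbf R_y\in\mathbb R^{2m\times2m}$); compute a singular value decomposition $\mathbf R_x\mathbf R_y^\top=\mathbf U\mathbf\Sigma\mathbf V^\top$ with $\mathbf U,\mathbf V\in\mathbb R^{2m\times 2m}$ orthogonal and $\mathbf\Sigma$ diagonal with nonincreasing nonnegative entries; set $\delta=\sigma_m(\mathbf R_x\mathbf R_y^\top)$ and $\widehat{\mathbf\Sigma}=\max(\mathbf\Sigma-\delta\mathbf I_{2m},\mathbf 0)$ (entrywise); replace $\mathbf A$ by $\widehat{\mathbf\Sigma}^{1/2}\mathbf U^\top\mathbf Q_x^\top$ and $\mathbf B$ by $\widehat{\mathbf\Sigma}^{1/2}\mathbf V^\top\mathbf Q_y^\top$; row position $j$ becomes unoccupied exactly when $\widehat\Sigma_{jj}=0$ (equivalently, the $j$-th rows of both $\mathbf A$ and $\mathbf B$ are zero). Output: the final $\mathbf A$ and $\mathbf B$. *)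

theory Defs
  imports
    Complex_Main
    "HOL-Library.Multiset"
    "Jordan_Normal_Form.Char_Poly"
begin

text \<open>
  The list contains the square roots of the eigenvalues of \<open>M\<^sup>T M\<close>, with multiplicity, in
  nonincreasing order. As \<open>M\<^sup>T M\<close> is positive semidefinite, its characteristic polynomial
  splits over the reals, so the list has length \<open>dim_col M\<close>.
\<close>

definition singular_values :: "real mat \<Rightarrow> real list" where
  "singular_values M =
     rev (sorted_list_of_multiset (image_mset sqrt (proots (char_poly (transpose_mat M * M)))))"

definition singular_value :: "nat \<Rightarrow> real mat \<Rightarrow> real" where
  "singular_value i M =
     (if 1 \<le> i \<and> i \<le> length (singular_values M) then singular_values M ! (i - 1) else 0)"

definition spectral_norm :: "real mat \<Rightarrow> real" where
  "spectral_norm M = singular_value 1 M"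

definition frobenius_norm :: "real mat \<Rightarrow> real" where
  "frobenius_norm M = sqrt (\<Sum>i<dim_row M. \<Sum>j<dim_col M. (M $$ (i, j))\<^sup>2)"

definition ky_fan_norm :: "nat \<Rightarrow> real mat \<Rightarrow> real" where
  "ky_fan_norm k M = (\<Sum>i=1..k. singular_value i M)"

text \<open>
  The library's \<^const>\<open>orthogonal_mat\<close> only requires pairwise orthogonal nonzero columns, hence
  the following predicate.
\<close>

definition orthonormal_cols :: "real mat \<Rightarrow> bool" where
  "orthonormal_cols Q \<longleftrightarrow> transpose_mat Q * Q = 1\<^sub>m (dim_col Q)"

text \<open>
  The reduced factorization is only meaningful for \<open>M\<close> with at least as many rows as columns.
\<close>

definition reduced_QR :: "real mat \<Rightarrow> real mat \<Rightarrow> real mat \<Rightarrow> bool" where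
  "reduced_QR M Q R \<longleftrightarrow>
     Q \<in> carrier_mat (dim_row M) (dim_col M) \<and> R \<in> carrier_mat (dim_col M) (dim_col M) \<and>
     orthonormal_cols Q \<and> upper_triangular R \<and> M = Q * R"

definition is_SVD :: "real mat \<Rightarrow> real mat \<Rightarrow> real mat \<Rightarrow> real mat \<Rightarrow> bool" where
  "is_SVD M U S V \<longleftrightarrow>
     (let r = dim_row M; c = dim_col M in
       U \<in> carrier_mat r r \<and> S \<in> carrier_mat r c \<and> V \<in> carrier_mat c c \<and>
       orthonormal_cols U \<and> orthonormal_cols V \<and>
       diagonal_mat S \<and>
       (\<forall>i < min r c. 0 \<le> S $$ (i, i)) \<and>
       (\<forall>i j. i \<le> j \<longrightarrow> j < min r c \<longrightarrow> S $$ (j, j) \<le> S $$ (i, i)) \<and>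
       M = U * S * transpose_mat V)"

text \<open>
  QR factorizations, singular value decompositions and the choice of an unoccupied row are not
  unique, so the algorithm is modelled as a relation. Rows are numbered from 0.

  \<open>cod_shrink m A B A' B' S'\<close>: the compression of the full sketch \<open>(A, B)\<close> may yield \<open>(A', B')\<close>,
  with shrunken diagonal matrix \<open>S'\<close>. As \<open>S'\<close> is diagonal and nonnegative, its square root is the
  entrywise one.
\<close>

definition cod_shrink ::
  "nat \<Rightarrow> real mat \<Rightarrow> real mat \<Rightarrow> real mat \<Rightarrow> real mat \<Rightarrow> real mat \<Rightarrow> bool" where
  "cod_shrink m A B A' B' S' \<longleftrightarrow>
     (\<exists>Qx Rx Qy Ry U S V.
        reduced_QR (transpose_mat A) Qx Rx \<and>
        reduced_QR (transpose_mat B) Qy Ry \<and>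
        is_SVD (Rx * transpose_mat Ry) U S V \<and>
        (let \<delta> = singular_value m (Rx * transpose_mat Ry) in
           S' = map_mat (\<lambda>s. max s 0) (S - \<delta> \<cdot>\<^sub>m 1\<^sub>m (2 * m))) \<and>
        A' = map_mat sqrt S' * transpose_mat U * transpose_mat Qx \<and>
        B' = map_mat sqrt S' * transpose_mat V * transpose_mat Qy)"

definition set_row :: "nat \<Rightarrow> real vec \<Rightarrow> real mat \<Rightarrow> real mat" where
  "set_row j v A = change_row j (\<lambda>c _. v $ c) A"

text \<open>
  \<open>cod_run m X Y t A B occ\<close>: after processing the first \<open>t\<close> rows of \<open>X\<close> and \<open>Y\<close>, the sketch may be
  \<open>(A, B)\<close> with set \<open>occ\<close> of occupied row positions.
\<close>

inductive cod_run ::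
  "nat \<Rightarrow> real mat \<Rightarrow> real mat \<Rightarrow> nat \<Rightarrow> real mat \<Rightarrow> real mat \<Rightarrow> nat set \<Rightarrow> bool"
  for m :: nat and X Y :: "real mat"
where
  init: "cod_run m X Y 0 (0\<^sub>m (2 * m) (dim_col X)) (0\<^sub>m (2 * m) (dim_col Y)) {}"
| insert:
    "\<lbrakk> cod_run m X Y t A B occ; t < dim_row X; j < 2 * m; j \<notin> occ;
       insert j occ \<noteq> {..<2 * m} \<rbrakk>
     \<Longrightarrow> cod_run m X Y (Suc t) (set_row j (row X t) A) (set_row j (row Y t) B) (insert j occ)"
| insert_shrink:
    "\<lbrakk> cod_run m X Y t A B occ; t < dim_row X; j < 2 * m; j \<notin> occ;
       insert j occ = {..<2 * m};
       cod_shrink m (set_row j (row X t) A) (set_row j (row Y t) B) A' B' S' \<rbrakk>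
     \<Longrightarrow> cod_run m X Y (Suc t) A' B' {i. i < 2 * m \<and> S' $$ (i, i) \<noteq> 0}"

definition cod_output :: "nat \<Rightarrow> real mat \<Rightarrow> real mat \<Rightarrow> real mat \<Rightarrow> real mat \<Rightarrow> bool" where
  "cod_output m X Y A B \<longleftrightarrow> (\<exists>occ. cod_run m X Y (dim_row X) A B occ)"

end

theory Submission
  imports Defs "HOL-Analysis.L2_Norm"
begin

text \<open>
  Let \<open>E\<close> be the approximation error and \<open>\<Delta>\<close> the sum of all shrinkage amounts \<open>\<delta>\<close>. Each shrinkage
  perturbs \<open>A\<^sup>T B\<close> by a matrix of spectral norm at most \<open>\<delta>\<close> and lowers its nuclear norm by at least
  \<open>m \<delta>\<close>; inserting a pair of rows \<open>x\<close>, \<open>y\<close> raises that norm by at most \<open>|x| |y|\<close>. Hence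
  \<open>\<parallel>E\<parallel>\<^sub>2 \<le> \<Delta>\<close> and, by Cauchy--Schwarz, the final nuclear norm is at most
  \<open>\<parallel>X\<parallel>\<^sub>F \<parallel>Y\<parallel>\<^sub>F - m \<Delta>\<close>. Testing \<open>X\<^sup>T Y = A\<^sup>T B + E\<close> against the top \<open>k\<close> pairs of singular vectors gives
  \<open>\<parallel>X\<^sup>T Y\<parallel>\<^sub>k \<le> \<parallel>X\<parallel>\<^sub>F \<parallel>Y\<parallel>\<^sub>F - m \<Delta> + k \<Delta>\<close>, which is solved for \<open>\<Delta>\<close>. The nuclear norm only enters through
  its dual description.
\<close>

subsection \<open>The spectral theorem for real symmetric matrices\<close>

lemma real_scalar_prod_self_nonneg: "(v :: real vec) \<bullet> v \<ge> 0"
  by (simp add: scalar_prod_def sum_nonneg)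

lemma real_scalar_prod_self_eq_0:
  assumes "(v :: real vec) \<in> carrier_vec n" "v \<bullet> v = 0"
  shows "v = 0\<^sub>v n"
proof (rule eq_vecI)
  fix i assume i: "i < dim_vec (0\<^sub>v n :: real vec)"
  have "\<forall>i\<in>{0..<n}. v $ i * v $ i = 0"
    using assms by (subst sum_nonneg_eq_0_iff [symmetric]) (auto simp: scalar_prod_def)
  with i show "v $ i = 0\<^sub>v n $ i" by auto
qed (use assms in auto)

text \<open>Over the complex numbers the characteristic polynomial has a root, which is where
  \<open>0 < n\<close> enters. Symmetry forces the root to be real, and then the real or the
  imaginary part of a complex eigenvector is a real one, to be normalised.\<close>

lemma symmetric_real_eigenvector:
  fixes S :: "real mat"
  assumes S: "S \<in> carrier_mat n n" and sym: "transpose_mat S = S" and n: "0 < n"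
  obtains v c where "v \<in> carrier_vec n" "v \<bullet> v = 1" "S *\<^sub>v v = c \<cdot>\<^sub>v v"
proof -
  define C where "C = map_mat complex_of_real S"
  have C: "C \<in> carrier_mat n n" using S by (simp add: C_def)
  obtain as where as: "char_poly C = (\<Prod>a\<leftarrow>as. [:- a, 1:])" "length as = n"
    using char_poly_factorized [OF C] by blast
  obtain a as' where "as = a # as'" using as n by (cases as) auto
  then have "poly (char_poly C) a = 0" by (simp add: as)
  then have "eigenvalue C a" using eigenvalue_root_char_poly [OF C] by simp
  then obtain z where z: "z \<in> carrier_vec n" "z \<noteq> 0\<^sub>v n" "C *\<^sub>v z = a \<cdot>\<^sub>v z"
    using C unfolding eigenvalue_def eigenvector_def by auto
  define x where "x = map_vec Re z"
  define y where "y = map_vec Im z"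
  have x: "x \<in> carrier_vec n" and y: "y \<in> carrier_vec n"
    using z by (auto simp: x_def y_def)
  have entry: "(\<Sum>j\<in>{0..<n}. complex_of_real (S $$ (i, j)) * z $ j) = a * z $ i" if "i < n" for i
  proof -
    have "(C *\<^sub>v z) $ i = (a \<cdot>\<^sub>v z) $ i" using z by simp
    then show ?thesis using that z(1) C S
      by (simp add: scalar_prod_def C_def)
  qed
  \<comment> \<open>As \<open>S\<close> is real, the equation \<open>C z = a z\<close> splits into
    its real and imaginary parts.\<close>
  have Sx: "S *\<^sub>v x = Re a \<cdot>\<^sub>v x - Im a \<cdot>\<^sub>v y"
  proof (rule eq_vecI)
    fix i assume "i < dim_vec (Re a \<cdot>\<^sub>v x - Im a \<cdot>\<^sub>v y)"
    then have i: "i < n" using y by simp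
    show "(S *\<^sub>v x) $ i = (Re a \<cdot>\<^sub>v x - Im a \<cdot>\<^sub>v y) $ i"
      using arg_cong [OF entry [OF i], of Re] i S x y z(1)
      by (simp add: scalar_prod_def x_def y_def)
  qed (use S y in simp)
  have Sy: "S *\<^sub>v y = Re a \<cdot>\<^sub>v y + Im a \<cdot>\<^sub>v x"
  proof (rule eq_vecI)
    fix i assume "i < dim_vec (Re a \<cdot>\<^sub>v y + Im a \<cdot>\<^sub>v x)"
    then have i: "i < n" using x by simp
    show "(S *\<^sub>v y) $ i = (Re a \<cdot>\<^sub>v y + Im a \<cdot>\<^sub>v x) $ i"
      using arg_cong [OF entry [OF i], of Im] i S x y z(1)
      by (simp add: scalar_prod_def x_def y_def algebra_simps)
  qed (use S x in simp)
  \<comment> \<open>By symmetry the two sides agree; their \<open>Re a\<close> terms are equal and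
    cancel, which leaves \<open>Im a\<close> times the squared length of \<open>z\<close>.\<close>
  have "y \<bullet> (S *\<^sub>v x) = (S *\<^sub>v y) \<bullet> x"
    using transpose_vec_mult_scalar [OF S x y] sym by simp
  then have "Im a * (x \<bullet> x + y \<bullet> y) = 0"
    using x y comm_scalar_prod [OF x y]
    by (simp add: Sx Sy scalar_prod_minus_distrib [of _ n] add_scalar_prod_distrib [of _ n] algebra_simps)
  moreover have nz: "x \<noteq> 0\<^sub>v n \<or> y \<noteq> 0\<^sub>v n"
  proof (rule ccontr)
    assume "\<not> ?thesis"
    then have "x $ i = 0 \<and> y $ i = 0" if "i < n" for i using that by auto
    then have "z = 0\<^sub>v n" using z(1) by (intro eq_vecI) (auto simp: x_def y_def complex_eq_iff)
    with z(2) show False by simp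
  qed
  then have "x \<bullet> x + y \<bullet> y \<noteq> 0"
    using real_scalar_prod_self_eq_0 [OF x] real_scalar_prod_self_eq_0 [OF y]
      real_scalar_prod_self_nonneg [of x] real_scalar_prod_self_nonneg [of y] by linarith
  ultimately have "Im a = 0" by simp
  then have "S *\<^sub>v x = Re a \<cdot>\<^sub>v x" "S *\<^sub>v y = Re a \<cdot>\<^sub>v y"
    using x y by (auto simp: Sx Sy)
  with nz x y obtain w where w: "w \<in> carrier_vec n" "w \<noteq> 0\<^sub>v n" "S *\<^sub>v w = Re a \<cdot>\<^sub>v w"
    by blast
  define r where "r = sqrt (w \<bullet> w)"
  have r: "r * r = w \<bullet> w" "r \<noteq> 0"
    using real_scalar_prod_self_eq_0 [OF w(1)] w(2) real_scalar_prod_self_nonneg [of w]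
    by (auto simp: r_def)
  show thesis
  proof
    show "(1 / r) \<cdot>\<^sub>v w \<in> carrier_vec n" using w by simp
    show "((1 / r) \<cdot>\<^sub>v w) \<bullet> ((1 / r) \<cdot>\<^sub>v w) = 1"
      using w(1) r by (simp add: r(1) [symmetric])
    show "S *\<^sub>v ((1 / r) \<cdot>\<^sub>v w) = Re a \<cdot>\<^sub>v ((1 / r) \<cdot>\<^sub>v w)"
      using w S by (simp add: mult_mat_vec [of _ n n] smult_smult_assoc mult.commute)
  qed
qed

text \<open>The witness is the Householder reflection interchanging \<open>v\<close> and the first unit vector.\<close>

lemma unit_vec_extends_to_orthonormal:
  fixes v :: "real vec"
  assumes v: "v \<in> carrier_vec (Suc n)" and unit: "v \<bullet> v = 1"
  obtains W where "W \<in> carrier_mat (Suc n) (Suc n)" "transpose_mat W * W = 1\<^sub>m (Suc n)" "col W 0 = v"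
proof (cases "v = unit_vec (Suc n) 0")
  case True
  then show thesis by (intro that [of "1\<^sub>m (Suc n)"]) auto
next
  case False
  define N where "N = Suc n"
  define w where "w = v - unit_vec N 0"
  have w: "w \<in> carrier_vec N" using v by (simp add: w_def N_def)
  have v': "v \<in> carrier_vec N" and N: "0 < N" using v by (simp_all add: N_def)
  have ww: "w \<bullet> w = 2 * (1 - v $ 0)"
    using v' N unit by (simp add: w_def scalar_prod_minus_distrib [of _ N] minus_scalar_prod_distrib [of _ N])
  have "w \<bullet> w \<noteq> 0"
  proof
    assume "w \<bullet> w = 0"
    then have "w = 0\<^sub>v N" using real_scalar_prod_self_eq_0 [OF w] by simp
    then have "v $ i = unit_vec N 0 $ i" if "i < N" for i
    proof -
      have "w $ i = 0" using \<open>w = 0\<^sub>v N\<close> that by simp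
      then show ?thesis using that v' by (simp add: w_def del: index_unit_vec(1,2))
    qed
    then have "v = unit_vec N 0" using v' by (intro eq_vecI) auto
    with False show False by (simp add: N_def)
  qed
  \<comment> \<open>By \<open>ww\<close> this is \<open>2 / (w \<bullet> w)\<close>, the coefficient
    for which \<open>I - c w w^T\<close> is a reflection.\<close>
  define c where "c = 1 / (1 - v $ 0)"
  have c: "c * (w \<bullet> w) = 2" and c': "c * (1 - v $ 0) = 1"
    using ww \<open>w \<bullet> w \<noteq> 0\<close> by (auto simp: c_def field_simps)
  define W where "W = mat N N (\<lambda>(i, j). (if i = j then 1 else 0) - c * w $ i * w $ j)"
  have W: "W \<in> carrier_mat N N" by (simp add: W_def)
  have orth: "transpose_mat W * W = 1\<^sub>m N"
  proof (rule eq_matI)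
    fix i j assume "i < dim_row (1\<^sub>m N :: real mat)" "j < dim_col (1\<^sub>m N :: real mat)"
    then have ij: "i < N" "j < N" by auto
    have "(transpose_mat W * W) $$ (i, j) = (\<Sum>k\<in>{0..<N}. W $$ (k, i) * W $$ (k, j))"
      using ij W by (simp add: scalar_prod_def)
    also have "\<dots> = (\<Sum>k\<in>{0..<N}. ((if k = i then 1 else 0) - c * w $ k * w $ i) *
          ((if k = j then 1 else 0) - c * w $ k * w $ j))"
      using ij by (intro sum.cong) (auto simp: W_def)
    also have "\<dots> = (\<Sum>k\<in>{0..<N}. (if k = i then (if i = j then 1 else 0) - c * w $ i * w $ j else 0)
        - (if k = j then c * w $ j * w $ i else 0) + (c * w $ i * (c * w $ j)) * (w $ k * w $ k))"
      by (intro sum.cong) (auto simp: algebra_simps)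
    also have "\<dots> = (if i = j then 1 else 0) - c * w $ i * w $ j - c * w $ j * w $ i
        + (c * w $ i * (c * w $ j)) * (w \<bullet> w)"
      using ij w by (simp add: sum.distrib sum_subtractf sum_distrib_left [symmetric] scalar_prod_def)
    also have "(c * w $ i * (c * w $ j)) * (w \<bullet> w) = c * w $ i * w $ j * (c * (w \<bullet> w))"
      by (simp only: ac_simps)
    finally show "(transpose_mat W * W) $$ (i, j) = 1\<^sub>m N $$ (i, j)"
      using ij by (simp add: c)
  qed (auto simp: W_def)
  have "col W 0 = v"
  proof (rule eq_vecI)
    fix i assume "i < dim_vec v"
    then have i: "i < N" using v' by simp
    \<comment> \<open>With \<open>c * w $ 0 = -1\<close>, column 0 of \<open>W\<close> is the first
      unit vector plus \<open>w\<close>, hence \<open>v\<close>.\<close>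
    have w0: "w $ 0 = - (1 - v $ 0)" using N v' by (simp add: w_def)
    have "c * w $ i * w $ 0 = - (w $ i * (c * (1 - v $ 0)))"
      unfolding w0 by (simp only: mult_minus_right ac_simps)
    then have "c * w $ i * w $ 0 = - w $ i" by (simp add: c')
    then show "col W 0 $ i = v $ i"
      using i N v' by (auto simp: W_def w_def)
  qed (use W v' in auto)
  with W orth show thesis using that by (simp add: N_def)
qed

text \<open>Deflation: complete a unit eigenvector to an orthonormal basis \<open>W\<close>. In this
  basis \<open>S\<close> splits into a 1 by 1 block and a smaller symmetric block, to which the
  induction hypothesis applies.\<close>

theorem real_spectral_decomposition:
  fixes S :: "real mat"
  assumes "S \<in> carrier_mat n n" and "transpose_mat S = S"
  obtains V D where "V \<in> carrier_mat n n" "D \<in> carrier_mat n n" "transpose_mat V * V = 1\<^sub>m n"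
    "diagonal_mat D" "S = V * D * transpose_mat V"
proof -
  have "\<exists>V D. V \<in> carrier_mat n n \<and> D \<in> carrier_mat n n \<and> transpose_mat V * V = 1\<^sub>m n \<and>
    diagonal_mat D \<and> transpose_mat V * S * V = D"
    using assms
  proof (induction n arbitrary: S)
    case 0
    then show ?case
      by (intro exI [of _ "1\<^sub>m 0"] exI [of _ S]) (auto simp: diagonal_mat_def)
  next
    case (Suc n)
    note S = Suc.prems(1) and sym = Suc.prems(2)
    obtain v c where v: "v \<in> carrier_vec (Suc n)" "v \<bullet> v = 1" "S *\<^sub>v v = c \<cdot>\<^sub>v v"
      using symmetric_real_eigenvector [OF S sym] by blast
    obtain W where W: "W \<in> carrier_mat (Suc n) (Suc n)" "transpose_mat W * W = 1\<^sub>m (Suc n)"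
      "col W 0 = v"
      using unit_vec_extends_to_orthonormal [OF v(1,2)] by blast
    define T where "T = transpose_mat W * S * W"
    have T: "T \<in> carrier_mat (Suc n) (Suc n)" using W S by (simp add: T_def)
    have symT: "transpose_mat T = T"
      unfolding T_def using W(1) S sym
      by (simp add: transpose_mult [of _ "Suc n" "Suc n" _ "Suc n"] assoc_mult_mat [of _ "Suc n" "Suc n" _ "Suc n" _ "Suc n"])
    have symT': "T $$ (j, i) = T $$ (i, j)" if "i < Suc n" "j < Suc n" for i j
      using arg_cong [OF symT, of "\<lambda>M. M $$ (i, j)"] that T by simp
    have col0: "T $$ (i, 0) = (if i = 0 then c else 0)" if i: "i < Suc n" for i
    proof -
      have "T $$ (i, 0) = (transpose_mat W * (S * W)) $$ (i, 0)"
        unfolding T_def using W(1) S by (simp add: assoc_mult_mat [of _ "Suc n" "Suc n" _ "Suc n" _ "Suc n"])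
      also have "\<dots> = row (transpose_mat W) i \<bullet> col (S * W) 0"
        by (rule index_mult_mat(1)) (use i W(1) in auto)
      also have "col (S * W) 0 = S *\<^sub>v col W 0" by (rule col_mult2 [OF S W(1)]) simp
      also have "row (transpose_mat W) i = col W i" using i W(1) by simp
      finally have "T $$ (i, 0) = col W i \<bullet> (S *\<^sub>v col W 0)" .
      also have "\<dots> = c * (col W i \<bullet> col W 0)" using v W i by simp
      also have "col W i \<bullet> col W 0 = (transpose_mat W * W) $$ (i, 0)" using i W(1) by simp
      finally show ?thesis using i by (simp add: W(2))
    qed
    define S' where "S' = mat n n (\<lambda>(i, j). T $$ (Suc i, Suc j))"
    have S': "S' \<in> carrier_mat n n" by (simp add: S'_def)
    have "transpose_mat S' = S'" by (rule eq_matI) (auto simp: S'_def symT')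
    from Suc.IH [OF S' this] obtain V' D' where
      V': "V' \<in> carrier_mat n n" and D': "D' \<in> carrier_mat n n"
      and orth': "transpose_mat V' * V' = 1\<^sub>m n" and diag': "diagonal_mat D'"
      and eq': "transpose_mat V' * S' * V' = D'"
      by blast
    \<comment> \<open>The first column comes from the eigenvector equation, the first row then from
      symmetry.\<close>
    have T_eq: "T = four_block_mat (c \<cdot>\<^sub>m 1\<^sub>m 1) (0\<^sub>m 1 n) (0\<^sub>m n 1) S'"
      using T by (intro eq_matI) (auto simp: S'_def col0 symT' [of _ 0])
    define Z where "Z = four_block_mat (1\<^sub>m 1) (0\<^sub>m 1 n) (0\<^sub>m n 1) V'"
    have Z: "Z \<in> carrier_mat (Suc n) (Suc n)" using V' unfolding Z_def by auto
    have Zt: "transpose_mat Z = four_block_mat (1\<^sub>m 1) (0\<^sub>m 1 n) (0\<^sub>m n 1) (transpose_mat V')"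
      unfolding Z_def using V' by (subst transpose_four_block_mat [of _ 1 1 _ n _ n]) auto
    have ZZ: "transpose_mat Z * Z = 1\<^sub>m (Suc n)"
      unfolding Zt unfolding Z_def using V'
      by (subst mult_four_block_mat [of _ 1 1 _ n _ n _ _ 1 _ n]) (auto simp: orth')
    have ZTZ: "transpose_mat Z * T * Z = four_block_mat (c \<cdot>\<^sub>m 1\<^sub>m 1) (0\<^sub>m 1 n) (0\<^sub>m n 1) D'"
      unfolding Zt T_eq unfolding Z_def using V' S' D'
      by (simp add: mult_four_block_mat [of _ 1 1 _ n _ n _ _ 1 _ n] eq')
    have assoc: "A * B * C = A * (B * C)" if "A \<in> carrier_mat (Suc n) (Suc n)" "B \<in> carrier_mat (Suc n) (Suc n)"
      "C \<in> carrier_mat (Suc n) (Suc n)" for A B C :: "real mat"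
      using that by (rule assoc_mult_mat)
    note [simp] = transpose_mult [of _ "Suc n" "Suc n" _ "Suc n"]
    show ?case
    proof (intro exI conjI)
      show "W * Z \<in> carrier_mat (Suc n) (Suc n)" using W Z by simp
      show "four_block_mat (c \<cdot>\<^sub>m 1\<^sub>m 1) (0\<^sub>m 1 n) (0\<^sub>m n 1) D' \<in> carrier_mat (Suc n) (Suc n)"
        using D' by auto
      have "transpose_mat (W * Z) * (W * Z) = transpose_mat Z * ((transpose_mat W * W) * Z)"
        using W(1) Z by (simp add: assoc)
      then show "transpose_mat (W * Z) * (W * Z) = 1\<^sub>m (Suc n)"
        using W Z ZZ by simp
      show "diagonal_mat (four_block_mat (c \<cdot>\<^sub>m 1\<^sub>m 1) (0\<^sub>m 1 n) (0\<^sub>m n 1) D')"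
        using D' diag' by (auto simp: diagonal_mat_def)
      have "transpose_mat (W * Z) * S * (W * Z) = transpose_mat Z * T * Z"
        unfolding T_def using W(1) Z S by (simp add: assoc)
      with ZTZ show "transpose_mat (W * Z) * S * (W * Z) =
          four_block_mat (c \<cdot>\<^sub>m 1\<^sub>m 1) (0\<^sub>m 1 n) (0\<^sub>m n 1) D'" by simp
    qed
  qed
  then obtain V D where V: "V \<in> carrier_mat n n" and D: "D \<in> carrier_mat n n"
    and orth: "transpose_mat V * V = 1\<^sub>m n" and diag: "diagonal_mat D"
    and eq: "transpose_mat V * S * V = D" by blast
  \<comment> \<open>The induction delivers \<open>V^T S V = D\<close>. For square matrices the left
    inverse is also a right inverse, so this can be solved for \<open>S\<close>.\<close>
  have VV: "V * transpose_mat V = 1\<^sub>m n"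
    using mat_mult_left_right_inverse [of "transpose_mat V" n V] V orth by simp
  have "V * D * transpose_mat V = (V * transpose_mat V) * S * (V * transpose_mat V)"
    unfolding eq [symmetric] using V assms(1)
    by (simp add: assoc_mult_mat [of _ n n _ n _ n])
  then have "S = V * D * transpose_mat V" using VV assms(1) by simp
  with V D orth diag show thesis by (rule that)
qed

subsection \<open>Operator and nuclear norm bounds\<close>

definition vnorm :: "real vec \<Rightarrow> real" where
  "vnorm v = sqrt (v \<bullet> v)"

lemma vnorm_nonneg [simp]: "0 \<le> vnorm v"
  by (simp add: vnorm_def real_scalar_prod_self_nonneg)

lemma vnorm_sq: "vnorm v * vnorm v = v \<bullet> v"
  by (simp add: vnorm_def real_scalar_prod_self_nonneg)

lemma vnorm_L2_set: "vnorm v = L2_set (($) v) {0..<dim_vec v}"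
  by (simp add: vnorm_def L2_set_def scalar_prod_def power2_eq_square)

text \<open>Cauchy-Schwarz with absolute values inside the sum, so that the summands may first be
  multiplied by weights of bounded modulus.\<close>

lemma sum_abs_le_vnorm:
  assumes "u \<in> carrier_vec n" "v \<in> carrier_vec n"
  shows "(\<Sum>i<n. \<bar>u $ i\<bar> * \<bar>v $ i\<bar>) \<le> vnorm u * vnorm v"
  using L2_set_mult_ineq [of "($) u" "($) v" "{0..<n}"] assms
  by (auto simp: vnorm_L2_set atLeast0LessThan)

lemma scalar_prod_le_vnorm:
  assumes "u \<in> carrier_vec n" "v \<in> carrier_vec n"
  shows "u \<bullet> v \<le> vnorm u * vnorm v"
proof -
  have "u \<bullet> v \<le> (\<Sum>i<n. \<bar>u $ i\<bar> * \<bar>v $ i\<bar>)"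
    using assms unfolding scalar_prod_def
    by (auto simp: atLeast0LessThan abs_mult [symmetric] intro!: sum_mono)
  also have "\<dots> \<le> vnorm u * vnorm v" using assms by (rule sum_abs_le_vnorm)
  finally show ?thesis .
qed

lemma orthonormal_cols_scalar_prod:
  assumes "orthonormal_cols U" "i < dim_col U" "j < dim_col U"
  shows "col U i \<bullet> col U j = (if i = j then 1 else 0)"
proof -
  have "col U i \<bullet> col U j = (transpose_mat U * U) $$ (i, j)" using assms by simp
  also have "\<dots> = 1\<^sub>m (dim_col U) $$ (i, j)" using assms by (simp only: orthonormal_cols_def)
  finally show ?thesis using assms by simp
qed

lemma vnorm_orthonormal_col:
  assumes "orthonormal_cols U" "i < dim_col U"
  shows "vnorm (col U i) = 1"
  using orthonormal_cols_scalar_prod [OF assms(1,2,2)] by (simp add: vnorm_def)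

lemma orthonormal_cols_mult:
  assumes Q: "Q \<in> carrier_mat p n" "orthonormal_cols Q" and U: "U \<in> carrier_mat n r" "orthonormal_cols U"
  shows "orthonormal_cols (Q * U)"
proof -
  have "transpose_mat (Q * U) * (Q * U) = transpose_mat U * (transpose_mat Q * Q * U)"
    using Q(1) U(1) by (simp add: transpose_mult [of _ p n _ r] assoc_mult_mat [of _ r n _ p _ r]
        assoc_mult_mat [of _ n p _ n _ r])
  also have "transpose_mat Q * Q * U = U"
    using Q U by (simp add: orthonormal_cols_def del: assoc_mult_mat)
  finally show ?thesis using U by (simp add: orthonormal_cols_def)
qed

text \<open>The vector \<open>w = U U^T x\<close> is the orthogonal projection of \<open>x\<close>
  onto the span of the columns, and the squared length of \<open>x - w\<close> is
  nonnegative.\<close>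

lemma bessel_inequality:
  assumes U: "U \<in> carrier_mat p r" and orth: "orthonormal_cols U" and x: "x \<in> carrier_vec p"
  shows "vnorm (transpose_mat U *\<^sub>v x) \<le> vnorm x"
proof -
  define y where "y = transpose_mat U *\<^sub>v x"
  have y: "y \<in> carrier_vec r" using U x by (simp add: y_def)
  define w where "w = U *\<^sub>v y"
  have w: "w \<in> carrier_vec p" using U y by (simp add: w_def)
  have xw: "x \<bullet> w = y \<bullet> y"
    using transpose_vec_mult_scalar [OF U y x] by (simp add: y_def w_def)
  have "transpose_mat U *\<^sub>v w = (transpose_mat U * U) *\<^sub>v y"
    using U y by (simp add: w_def assoc_mult_mat_vec [of _ r p _ r])
  also have "\<dots> = y" using orth U y by (simp add: orthonormal_cols_def del: assoc_mult_mat_vec)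
  finally have "transpose_mat U *\<^sub>v w = y" .
  then have ww: "w \<bullet> w = y \<bullet> y"
    using transpose_vec_mult_scalar [OF U y w] by (simp add: w_def)
  have "0 \<le> (x - w) \<bullet> (x - w)" by (rule real_scalar_prod_self_nonneg)
  also have "\<dots> = x \<bullet> x - y \<bullet> y"
    using x w xw ww comm_scalar_prod [OF x w]
    by (simp add: scalar_prod_minus_distrib [of _ p] minus_scalar_prod_distrib [of _ p])
  finally show ?thesis by (simp add: vnorm_def y_def)
qed

text \<open>For \<open>c \<ge> 0\<close> this is the bilinear description of a spectral norm of at
  most \<open>c\<close>. It makes the triangle inequality immediate; \<open>spectral_norm_le\<close>
  translates back to singular values.\<close>

definition op_norm_le :: "real mat \<Rightarrow> real \<Rightarrow> bool" where
  "op_norm_le E c \<longleftrightarrow> (\<forall>u \<in> carrier_vec (dim_row E). \<forall>v \<in> carrier_vec (dim_col E).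
     u \<bullet> (E *\<^sub>v v) \<le> c * (vnorm u * vnorm v))"

text \<open>By the duality between the nuclear and the spectral norm, this says that the nuclear norm
  of \<open>P\<close> is at most \<open>c\<close>.\<close>

definition nuclear_norm_le :: "real mat \<Rightarrow> real \<Rightarrow> bool" where
  "nuclear_norm_le P c \<longleftrightarrow> (\<forall>r U V. U \<in> carrier_mat (dim_row P) r \<longrightarrow> V \<in> carrier_mat (dim_col P) r \<longrightarrow>
     orthonormal_cols U \<longrightarrow> orthonormal_cols V \<longrightarrow> (\<Sum>j<r. col U j \<bullet> (P *\<^sub>v col V j)) \<le> c)"

lemma op_norm_leD:
  "\<lbrakk>op_norm_le E c; E \<in> carrier_mat p q; u \<in> carrier_vec p; v \<in> carrier_vec q\<rbrakk>
   \<Longrightarrow> u \<bullet> (E *\<^sub>v v) \<le> c * (vnorm u * vnorm v)"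
  by (auto simp: op_norm_le_def)

lemma nuclear_norm_leD:
  "\<lbrakk>nuclear_norm_le P c; P \<in> carrier_mat p q; U \<in> carrier_mat p r; V \<in> carrier_mat q r;
    orthonormal_cols U; orthonormal_cols V\<rbrakk> \<Longrightarrow> (\<Sum>j<r. col U j \<bullet> (P *\<^sub>v col V j)) \<le> c"
  by (auto simp: nuclear_norm_le_def)

lemma nuclear_norm_le_mono: "\<lbrakk>nuclear_norm_le P c; c \<le> d\<rbrakk> \<Longrightarrow> nuclear_norm_le P d"
  unfolding nuclear_norm_le_def by (meson order_trans)

lemma op_norm_le_add:
  assumes "op_norm_le E c" "op_norm_le F d" "E \<in> carrier_mat p q" "F \<in> carrier_mat p q"
  shows "op_norm_le (E + F) (c + d)"
  unfolding op_norm_le_def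
proof (intro ballI)
  fix u v :: "real vec"
  assume "u \<in> carrier_vec (dim_row (E + F))" "v \<in> carrier_vec (dim_col (E + F))"
  then have u: "u \<in> carrier_vec p" and v: "v \<in> carrier_vec q" using assms by auto
  have "u \<bullet> ((E + F) *\<^sub>v v) = u \<bullet> (E *\<^sub>v v) + u \<bullet> (F *\<^sub>v v)"
    using u v assms by (simp add: add_mult_distrib_mat_vec [of _ p q] scalar_prod_add_distrib [of _ p])
  then show "u \<bullet> ((E + F) *\<^sub>v v) \<le> (c + d) * (vnorm u * vnorm v)"
    using op_norm_leD [OF assms(1,3) u v] op_norm_leD [OF assms(2,4) u v] by (simp add: distrib_right)
qed

text \<open>Testing \<open>x y^T\<close> against \<open>U\<close> and \<open>V\<close> gives the
  inner product of \<open>U^T x\<close> and \<open>V^T y\<close>, which Cauchy-Schwarz and Bessel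
  bound by the product of the lengths of \<open>x\<close> and \<open>y\<close>.\<close>

lemma nuclear_norm_le_add_rank_one:
  assumes P: "P \<in> carrier_mat p q" and le: "nuclear_norm_le P c"
    and x: "x \<in> carrier_vec p" and y: "y \<in> carrier_vec q"
  shows "nuclear_norm_le (P + mat p q (\<lambda>(i, j). x $ i * y $ j)) (c + vnorm x * vnorm y)"
  unfolding nuclear_norm_le_def
proof (intro allI impI)
  fix r U V
  let ?R = "mat p q (\<lambda>(i, j). x $ i * y $ j)"
  assume *: "U \<in> carrier_mat (dim_row (P + ?R)) r" "V \<in> carrier_mat (dim_col (P + ?R)) r"
    "orthonormal_cols U" "orthonormal_cols V"
  then have U: "U \<in> carrier_mat p r" and V: "V \<in> carrier_mat q r" by auto
  have rank_one: "u \<bullet> (?R *\<^sub>v v) = (u \<bullet> x) * (v \<bullet> y)" if "u \<in> carrier_vec p" "v \<in> carrier_vec q" for u v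
  proof -
    have "u \<bullet> (?R *\<^sub>v v) = (\<Sum>i\<in>{0..<p}. \<Sum>j\<in>{0..<q}. u $ i * (v $ j * (x $ i * y $ j)))"
      using that x y by (simp add: scalar_prod_def sum_distrib_left ac_simps)
    also have "\<dots> = (u \<bullet> x) * (v \<bullet> y)"
      using that x y unfolding scalar_prod_def sum_product by (auto simp: ac_simps)
    finally show ?thesis .
  qed
  have "(\<Sum>j<r. col U j \<bullet> ((P + ?R) *\<^sub>v col V j))
      = (\<Sum>j<r. col U j \<bullet> (P *\<^sub>v col V j)) + (\<Sum>j<r. (col U j \<bullet> x) * (col V j \<bullet> y))"
    unfolding sum.distrib [symmetric]
  proof (rule sum.cong)
    fix j assume "j \<in> {..<r}"
    then have u: "col U j \<in> carrier_vec p" and v: "col V j \<in> carrier_vec q" using U V by auto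
    have R: "?R \<in> carrier_mat p q" by simp
    show "col U j \<bullet> ((P + ?R) *\<^sub>v col V j) = col U j \<bullet> (P *\<^sub>v col V j) + (col U j \<bullet> x) * (col V j \<bullet> y)"
      unfolding add_mult_distrib_mat_vec [OF P R v] rank_one [OF u v, symmetric]
      by (rule scalar_prod_add_distrib [OF u]) (use P R v in \<open>auto intro!: mult_mat_vec_carrier\<close>)
  qed simp
  also have "(\<Sum>j<r. (col U j \<bullet> x) * (col V j \<bullet> y)) = (transpose_mat U *\<^sub>v x) \<bullet> (transpose_mat V *\<^sub>v y)"
    using U V by (auto simp: scalar_prod_def [of "mult_mat_vec _ _"] atLeast0LessThan)
  also have "\<dots> \<le> vnorm (transpose_mat U *\<^sub>v x) * vnorm (transpose_mat V *\<^sub>v y)"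
    by (rule scalar_prod_le_vnorm [of _ r]) (use U V x y in auto)
  also have "\<dots> \<le> vnorm x * vnorm y"
    using * U V x y by (intro mult_mono bessel_inequality) auto
  finally show "(\<Sum>j<r. col U j \<bullet> ((P + ?R) *\<^sub>v col V j)) \<le> c + vnorm x * vnorm y"
    using nuclear_norm_leD [OF le P U V] * by simp
qed

section \<open>Products \<open>A S B^T\<close> with diagonal \<open>S\<close>\<close>

lemma diagonal_mult_mat_vec_index:
  fixes S :: "'a :: semiring_1 mat"
  assumes S: "S \<in> carrier_mat n n" "diagonal_mat S" and b: "b \<in> carrier_vec n" and i: "i < n"
  shows "(S *\<^sub>v b) $ i = S $$ (i, i) * b $ i"
proof -
  have "(S *\<^sub>v b) $ i = (\<Sum>k<n. S $$ (i, k) * b $ k)"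
    using i S b by (simp add: scalar_prod_def atLeast0LessThan)
  also have "\<dots> = (\<Sum>k<n. if k = i then S $$ (i, i) * b $ i else 0)"
    using i S by (intro sum.cong) (auto simp: diagonal_mat_def)
  finally show ?thesis using i by simp
qed

lemma diagonal_mult_mat_index:
  fixes S :: "'a :: semiring_1 mat"
  assumes S: "S \<in> carrier_mat n n" "diagonal_mat S" and T: "T \<in> carrier_mat n q" and ij: "i < n" "j < q"
  shows "(S * T) $$ (i, j) = S $$ (i, i) * T $$ (i, j)"
  using diagonal_mult_mat_vec_index [OF S, of "col T j" i] S T ij by simp

lemma transpose_diagonal_mat:
  assumes "S \<in> carrier_mat n n" "diagonal_mat S"
  shows "transpose_mat S = S"
  using assms by (intro eq_matI) (auto simp: diagonal_mat_def, metis)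

text \<open>The product is a weighted sum of outer products of corresponding columns of
  \<open>A\<close> and \<open>B\<close>. The bounds on both norms of such products start from this
  expansion.\<close>

lemma scalar_prod_diagonal_sandwich:
  fixes S :: "real mat"
  assumes A: "A \<in> carrier_mat p n" and S: "S \<in> carrier_mat n n" "diagonal_mat S" and B: "B \<in> carrier_mat q n"
    and u: "u \<in> carrier_vec p" and v: "v \<in> carrier_vec q"
  shows "u \<bullet> ((A * S * transpose_mat B) *\<^sub>v v) = (\<Sum>i<n. S $$ (i, i) * ((col A i \<bullet> u) * (col B i \<bullet> v)))"
proof -
  define b where "b = transpose_mat B *\<^sub>v v"
  have b: "b \<in> carrier_vec n" using B v by (simp add: b_def)
  have Sb: "(S *\<^sub>v b) $ i = S $$ (i, i) * b $ i" if "i < n" for i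
    using that by (rule diagonal_mult_mat_vec_index [OF S b])
  have "u \<bullet> ((A * S * transpose_mat B) *\<^sub>v v) = u \<bullet> (A *\<^sub>v (S *\<^sub>v b))"
    using A S B v u by (simp add: b_def assoc_mult_mat_vec [of _ p n _ q] assoc_mult_mat_vec [of _ p n _ n])
  also have "\<dots> = (transpose_mat A *\<^sub>v u) \<bullet> (S *\<^sub>v b)"
    using transpose_vec_mult_scalar [OF A _ u, of "S *\<^sub>v b"] S b by simp
  also have "\<dots> = (\<Sum>i<n. (col A i \<bullet> u) * (S *\<^sub>v b) $ i)"
    using A S b by (auto simp: scalar_prod_def [of "mult_mat_vec _ _"] atLeast0LessThan simp del: index_mult_mat_vec(1) intro!: sum.cong)
      (simp add: row_transpose)
  also have "\<dots> = (\<Sum>i<n. S $$ (i, i) * ((col A i \<bullet> u) * (col B i \<bullet> v)))"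
    by (intro sum.cong) (use Sb B in \<open>auto simp: b_def\<close>)
  finally show ?thesis .
qed

text \<open>After the weights are replaced by \<open>c\<close>, Cauchy-Schwarz applies to the
  coefficient vectors \<open>A^T u\<close> and \<open>B^T v\<close>, and Bessel bounds their
  lengths.\<close>

lemma op_norm_le_diagonal_sandwich:
  fixes S :: "real mat"
  assumes A: "A \<in> carrier_mat p n" "orthonormal_cols A" and B: "B \<in> carrier_mat q n" "orthonormal_cols B"
    and S: "S \<in> carrier_mat n n" "diagonal_mat S" and c: "\<And>i. i < n \<Longrightarrow> \<bar>S $$ (i, i)\<bar> \<le> c" and "0 \<le> c"
  shows "op_norm_le (A * S * transpose_mat B) c"
  unfolding op_norm_le_def
proof (intro ballI)
  fix u v :: "real vec"
  assume "u \<in> carrier_vec (dim_row (A * S * transpose_mat B))" "v \<in> carrier_vec (dim_col (A * S * transpose_mat B))"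
  then have u: "u \<in> carrier_vec p" and v: "v \<in> carrier_vec q" using A B by auto
  let ?a = "transpose_mat A *\<^sub>v u" and ?b = "transpose_mat B *\<^sub>v v"
  have "u \<bullet> ((A * S * transpose_mat B) *\<^sub>v v) = (\<Sum>i<n. S $$ (i, i) * (?a $ i * ?b $ i))"
    using A B by (subst scalar_prod_diagonal_sandwich [OF A(1) S B(1) u v]) auto
  also have "\<dots> \<le> (\<Sum>i<n. c * (\<bar>?a $ i\<bar> * \<bar>?b $ i\<bar>))"
  proof (rule sum_mono)
    fix i assume "i \<in> {..<n}"
    have "S $$ (i, i) * (?a $ i * ?b $ i) \<le> \<bar>S $$ (i, i)\<bar> * (\<bar>?a $ i\<bar> * \<bar>?b $ i\<bar>)"
      by (metis abs_ge_self abs_mult)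
    also have "\<dots> \<le> c * (\<bar>?a $ i\<bar> * \<bar>?b $ i\<bar>)"
      using c \<open>i \<in> {..<n}\<close> by (intro mult_right_mono) auto
    finally show "S $$ (i, i) * (?a $ i * ?b $ i) \<le> c * (\<bar>?a $ i\<bar> * \<bar>?b $ i\<bar>)" .
  qed
  also have "\<dots> \<le> c * (vnorm ?a * vnorm ?b)"
    unfolding sum_distrib_left [symmetric]
    using A B u v \<open>0 \<le> c\<close> by (intro mult_left_mono sum_abs_le_vnorm) auto
  also have "\<dots> \<le> c * (vnorm u * vnorm v)"
    using A B u v \<open>0 \<le> c\<close> by (intro mult_left_mono mult_mono bessel_inequality) auto
  finally show "u \<bullet> ((A * S * transpose_mat B) *\<^sub>v v) \<le> c * (vnorm u * vnorm v)" .
qed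

text \<open>Once the two sums are swapped, the weight \<open>S $$ (i, i)\<close> multiplies an inner
  product of the coefficient vectors of two unit vectors, which is at most 1. Nonnegative weights
  preserve this bound.\<close>

lemma nuclear_norm_le_diagonal_sandwich:
  fixes S :: "real mat"
  assumes A: "A \<in> carrier_mat p n" "orthonormal_cols A" and B: "B \<in> carrier_mat q n" "orthonormal_cols B"
    and S: "S \<in> carrier_mat n n" "diagonal_mat S" and pos: "\<And>i. i < n \<Longrightarrow> 0 \<le> S $$ (i, i)"
  shows "nuclear_norm_le (A * S * transpose_mat B) (\<Sum>i<n. S $$ (i, i))"
  unfolding nuclear_norm_le_def
proof (intro allI impI)
  fix r U V
  assume *: "U \<in> carrier_mat (dim_row (A * S * transpose_mat B)) r"
    "V \<in> carrier_mat (dim_col (A * S * transpose_mat B)) r" "orthonormal_cols U" "orthonormal_cols V"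
  then have U: "U \<in> carrier_mat p r" and V: "V \<in> carrier_mat q r" using A B by auto
  let ?a = "\<lambda>i. transpose_mat U *\<^sub>v col A i" and ?b = "\<lambda>i. transpose_mat V *\<^sub>v col B i"
  have "(\<Sum>j<r. col U j \<bullet> ((A * S * transpose_mat B) *\<^sub>v col V j))
      = (\<Sum>j<r. \<Sum>i<n. S $$ (i, i) * ((col A i \<bullet> col U j) * (col B i \<bullet> col V j)))"
    using U V by (intro sum.cong scalar_prod_diagonal_sandwich [OF A(1) S B(1)]) auto
  also have "\<dots> = (\<Sum>i<n. S $$ (i, i) * (\<Sum>j<r. (col A i \<bullet> col U j) * (col B i \<bullet> col V j)))"
    unfolding sum_distrib_left by (rule sum.swap)
  also have "\<dots> = (\<Sum>i<n. S $$ (i, i) * (?a i \<bullet> ?b i))"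
    using A B U V
    by (auto simp: scalar_prod_def [of "mult_mat_vec _ _"] atLeast0LessThan comm_scalar_prod [of _ p]
        comm_scalar_prod [of _ q] intro!: sum.cong)
  also have "\<dots> \<le> (\<Sum>i<n. S $$ (i, i) * 1)"
  proof (intro sum_mono mult_left_mono)
    fix i assume i: "i \<in> {..<n}"
    have "?a i \<bullet> ?b i \<le> vnorm (?a i) * vnorm (?b i)"
      by (rule scalar_prod_le_vnorm [of _ r]) (use U V A B in auto)
    also have "\<dots> \<le> vnorm (col A i) * vnorm (col B i)"
      using * U V A(1) B(1) i by (intro mult_mono bessel_inequality) auto
    also have "\<dots> = 1" using A B i by (simp add: vnorm_orthonormal_col)
    finally show "?a i \<bullet> ?b i \<le> 1" .
  qed (use pos in auto)
  finally show "(\<Sum>j<r. col U j \<bullet> ((A * S * transpose_mat B) *\<^sub>v col V j)) \<le> (\<Sum>i<n. S $$ (i, i))" by simp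
qed

text \<open>Take \<open>A\<close> and \<open>B\<close> themselves as the test families:
  orthonormality reduces the double sum to the trace of \<open>S\<close>. For nonnegative
  \<open>S\<close> this is the converse of the preceding bound.\<close>

lemma sum_diagonal_le_nuclear_norm:
  fixes S :: "real mat"
  assumes A: "A \<in> carrier_mat p n" "orthonormal_cols A" and B: "B \<in> carrier_mat q n" "orthonormal_cols B"
    and S: "S \<in> carrier_mat n n" "diagonal_mat S"
    and le: "nuclear_norm_le (A * S * transpose_mat B) c"
  shows "(\<Sum>i<n. S $$ (i, i)) \<le> c"
proof -
  have "(\<Sum>j<n. col A j \<bullet> ((A * S * transpose_mat B) *\<^sub>v col B j))
      = (\<Sum>j<n. \<Sum>i<n. S $$ (i, i) * ((col A i \<bullet> col A j) * (col B i \<bullet> col B j)))"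
    using A B by (intro sum.cong scalar_prod_diagonal_sandwich [OF A(1) S B(1)]) auto
  also have "\<dots> = (\<Sum>j<n. \<Sum>i<n. if i = j then S $$ (j, j) else 0)"
    using A B by (intro sum.cong) (auto simp: orthonormal_cols_scalar_prod)
  finally show ?thesis
    using nuclear_norm_leD [OF le, of p q A n B] A B S by simp
qed

subsection \<open>Singular values and Ky Fan norms\<close>

lemma orthonormal_colsI:
  assumes U: "U \<in> carrier_mat p r"
    and "\<And>i j. \<lbrakk>i < r; j < r\<rbrakk> \<Longrightarrow> col U i \<bullet> col U j = (if i = j then 1 else 0)"
  shows "orthonormal_cols U"
  unfolding orthonormal_cols_def using assms by (intro eq_matI) auto

lemma scalar_prod_mult_mat_vec:
  fixes M :: "real mat"
  assumes M: "M \<in> carrier_mat p q" and u: "u \<in> carrier_vec q" and v: "v \<in> carrier_vec q"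
  shows "(M *\<^sub>v u) \<bullet> (M *\<^sub>v v) = u \<bullet> ((transpose_mat M * M) *\<^sub>v v)"
proof -
  have "(M *\<^sub>v u) \<bullet> (M *\<^sub>v v) = (M *\<^sub>v v) \<bullet> (M *\<^sub>v u)"
    using M u v by (intro comm_scalar_prod [of _ p]) auto
  also have "\<dots> = (transpose_mat M *\<^sub>v (M *\<^sub>v v)) \<bullet> u"
    using M u v by (intro transpose_vec_mult_scalar [symmetric, of _ p q]) auto
  also have "\<dots> = u \<bullet> (transpose_mat M *\<^sub>v (M *\<^sub>v v))"
    using M u v by (intro comm_scalar_prod [of _ q]) auto
  finally show ?thesis using M v by (simp add: assoc_mult_mat_vec [of _ q p _ q])
qed

lemma proots_prod_list_linear:
  "proots (\<Prod>a\<leftarrow>as. [:- a, 1:]) = mset (as :: real list)"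
proof (induction as)
  case (Cons a as)
  have "(\<Prod>a\<leftarrow>as. [:- a, 1:]) \<noteq> 0" by (auto simp: prod_list_zero_iff)
  with Cons show ?case by (simp add: proots_mult del: mult_pCons_left)
qed simp

text \<open>\<open>V\<close> is orthogonal, so \<open>M^T M\<close> is similar to \<open>D\<close>
  and both have the same characteristic polynomial, whose roots are the diagonal entries of
  \<open>D\<close>.\<close>

lemma singular_values_eq:
  fixes M :: "real mat"
  assumes M: "M \<in> carrier_mat p q" and V: "V \<in> carrier_mat q q" "orthonormal_cols V"
    and D: "D \<in> carrier_mat q q" "diagonal_mat D"
    and eq: "transpose_mat M * M = V * D * transpose_mat V"
  shows "singular_values M = rev (sort (map (\<lambda>i. sqrt (D $$ (i, i))) [0..<q]))"
proof -
  have "transpose_mat V * V = 1\<^sub>m q" using V by (simp add: orthonormal_cols_def)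
  moreover from this have "V * transpose_mat V = 1\<^sub>m q"
    using mat_mult_left_right_inverse [of "transpose_mat V" q V] V by simp
  ultimately have "similar_mat_wit (transpose_mat M * M) D V (transpose_mat V)"
    using M V D by (intro similar_mat_witI [of _ _ q] eq) auto
  then have "char_poly (transpose_mat M * M) = char_poly D"
    by (intro char_poly_similar) (auto simp: similar_mat_def)
  also have "\<dots> = (\<Prod>a\<leftarrow>diag_mat D. [:- a, 1:])"
    using D by (intro char_poly_upper_triangular [of _ q]) (auto simp: diagonal_mat_def upper_triangular_def)
  finally have "proots (char_poly (transpose_mat M * M)) = mset (diag_mat D)"
    by (simp add: proots_prod_list_linear)
  moreover have "diag_mat D = map (\<lambda>i. D $$ (i, i)) [0..<q]" using D by (simp add: diag_mat_def)
  ultimately show ?thesis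
    by (simp add: singular_values_def mset_map [symmetric] o_def del: mset_map)
qed

text \<open>Here \<open>M^T M = V S^2 V^T\<close>, and the square roots of the diagonal of
  \<open>S^2\<close> are the entries of \<open>S\<close> because these are nonnegative. The result
  identifies the shrinkage amount with a diagonal entry; the index shifts since singular values are
  counted from 1.\<close>

lemma singular_value_SVD:
  fixes M :: "real mat"
  assumes M: "M \<in> carrier_mat n n" and svd: "is_SVD M U S V" and i: "1 \<le> i" "i \<le> n"
  shows "singular_value i M = S $$ (i - 1, i - 1)"
proof -
  have U: "U \<in> carrier_mat n n" "orthonormal_cols U" and V: "V \<in> carrier_mat n n" "orthonormal_cols V"
    and S: "S \<in> carrier_mat n n" "diagonal_mat S" and pos: "\<And>i. i < n \<Longrightarrow> 0 \<le> S $$ (i, i)"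
    and mono: "\<And>i j. i \<le> j \<Longrightarrow> j < n \<Longrightarrow> S $$ (j, j) \<le> S $$ (i, i)"
    and M_eq: "M = U * S * transpose_mat V"
    using svd M by (auto simp: is_SVD_def Let_def)
  note St = transpose_diagonal_mat [OF S]
  have SS: "(S * S) $$ (i, j) = (if i = j then S $$ (i, i) * S $$ (i, i) else 0)" if "i < n" "j < n" for i j
    using diagonal_mult_mat_index [OF S S(1) that] that S by (auto simp: diagonal_mat_def)
  note mult = assoc_mult_mat [of _ n n _ n _ n] transpose_mult [of _ n n _ n]
  have "transpose_mat M * M = V * S * (transpose_mat U * U) * S * transpose_mat V"
    unfolding M_eq using U V S by (simp add: mult St)
  also have "transpose_mat U * U = 1\<^sub>m n" using U by (simp add: orthonormal_cols_def)
  finally have "transpose_mat M * M = V * (S * S) * transpose_mat V"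
    using V S by (simp add: mult)
  then have "singular_values M = rev (sort (map (\<lambda>i. sqrt ((S * S) $$ (i, i))) [0..<n]))"
    using M V S by (intro singular_values_eq) (auto simp: SS diagonal_mat_def simp del: index_mult_mat(1))
  also have "map (\<lambda>i. sqrt ((S * S) $$ (i, i))) [0..<n] = map (\<lambda>i. S $$ (i, i)) [0..<n]"
    by (auto simp: SS pos simp del: index_mult_mat(1))
  \<comment> \<open>The diagonal is nonincreasing, so its reversal is sorted and the outer
    \<open>rev\<close> restores it.\<close>
  also have "sort (map (\<lambda>i. S $$ (i, i)) [0..<n]) = rev (map (\<lambda>i. S $$ (i, i)) [0..<n])"
    by (rule properties_for_sort) (auto simp: sorted_wrt_iff_nth_less rev_nth intro!: mono)
  finally have "singular_values M = map (\<lambda>i. S $$ (i, i)) [0..<n]" by simp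
  moreover have "i - 1 < n" using i by simp
  ultimately show ?thesis using i by (simp add: singular_value_def del: upt_Suc)
qed

text \<open>The largest singular value is the square root of an eigenvalue of \<open>E^T E\<close>.
  For an eigenvector \<open>v\<close> the image \<open>w = E v\<close> is longer than
  \<open>v\<close> by exactly that factor, and the bilinear bound is tested at \<open>w\<close> and
  \<open>v\<close>.\<close>

lemma spectral_norm_le:
  assumes E: "E \<in> carrier_mat p q" and le: "op_norm_le E c" and c: "0 \<le> c"
  shows "spectral_norm E \<le> c"
proof (cases "length (singular_values E) = 0")
  \<comment> \<open>On an empty list \<open>singular_value\<close> takes its default 0.\<close>
  case True
  then show ?thesis using c by (simp add: spectral_norm_def singular_value_def)
next
  case False
  let ?S = "transpose_mat E * E"
  have S: "?S \<in> carrier_mat q q" using E by simp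
  have "char_poly ?S \<noteq> 0" using degree_monic_char_poly [OF S] by auto
  moreover have "spectral_norm E \<in> set (singular_values E)"
    using False by (simp add: spectral_norm_def singular_value_def Suc_le_eq)
  ultimately obtain a where a: "poly (char_poly ?S) a = 0" "spectral_norm E = sqrt a"
    by (auto simp: singular_values_def)
  then have "eigenvalue ?S a" using eigenvalue_root_char_poly [OF S] by simp
  then obtain v where v: "v \<in> carrier_vec q" "v \<noteq> 0\<^sub>v q" "?S *\<^sub>v v = a \<cdot>\<^sub>v v"
    using E unfolding eigenvalue_def eigenvector_def by auto
  define w where "w = E *\<^sub>v v"
  have w: "w \<in> carrier_vec p" using E v by (simp add: w_def)
  have "vnorm w * vnorm w = a * (vnorm v * vnorm v)"
    using scalar_prod_mult_mat_vec [OF E v(1) v(1)] v by (simp add: vnorm_sq w_def)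
  then have "vnorm w = sqrt a * vnorm v"
    by (metis abs_of_nonneg real_sqrt_abs2 real_sqrt_mult vnorm_nonneg)
  moreover have "vnorm w * vnorm w \<le> c * (vnorm w * vnorm v)"
    using op_norm_leD [OF le E w v(1)] by (simp add: vnorm_sq w_def)
  \<comment> \<open>Cancel \<open>vnorm w\<close>; if it is 0, the claim follows from
    \<open>0 \<le> c\<close>.\<close>
  then have "vnorm w \<le> c * vnorm v"
    using c by (cases "vnorm w = 0") (auto simp: less_le)
  moreover have "vnorm v > 0"
    using real_scalar_prod_self_eq_0 [OF v(1)] v(2) real_scalar_prod_self_nonneg [of v]
    by (auto simp: vnorm_def less_le)
  ultimately show ?thesis using a(2) by simp
qed

text \<open>The columns of \<open>V\<close> are eigenvectors of \<open>M^T M\<close> for its largest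
  eigenvalues, those of \<open>U\<close> their normalised images under \<open>M\<close>. Images that
  vanish cannot be normalised and are dropped, so \<open>r\<close> may be smaller than
  \<open>k\<close>.\<close>

lemma ky_fan_norm_attained:
  assumes M: "M \<in> carrier_mat p q"
  obtains r U V where "r \<le> k" "U \<in> carrier_mat p r" "V \<in> carrier_mat q r"
    "orthonormal_cols U" "orthonormal_cols V"
    "ky_fan_norm k M = (\<Sum>j<r. col U j \<bullet> (M *\<^sub>v col V j))"
proof -
  let ?S = "transpose_mat M * M"
  have S: "?S \<in> carrier_mat q q" "transpose_mat ?S = ?S"
    using M by (simp_all add: transpose_mult [of _ q p _ q])
  obtain W D where W': "W \<in> carrier_mat q q" "transpose_mat W * W = 1\<^sub>m q"
    and D: "D \<in> carrier_mat q q" "diagonal_mat D" and S_eq: "?S = W * D * transpose_mat W"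
    by (rule real_spectral_decomposition [OF S])
  then have W: "W \<in> carrier_mat q q" "orthonormal_cols W"
    by (simp_all add: orthonormal_cols_def)
  have gram: "(M *\<^sub>v col W i) \<bullet> (M *\<^sub>v col W j) = (if i = j then D $$ (j, j) else 0)"
    if "i < q" "j < q" for i j
  proof -
    have "(M *\<^sub>v col W i) \<bullet> (M *\<^sub>v col W j) = col W i \<bullet> (?S *\<^sub>v col W j)"
      using M W that by (intro scalar_prod_mult_mat_vec) auto
    also have "\<dots> = (\<Sum>k<q. D $$ (k, k) * ((col W k \<bullet> col W i) * (col W k \<bullet> col W j)))"
      unfolding S_eq using that W by (intro scalar_prod_diagonal_sandwich D) auto
    also have "\<dots> = (\<Sum>k<q. if k = j then (if i = j then D $$ (j, j) else 0) else 0)"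
      using that W by (intro sum.cong) (auto simp: orthonormal_cols_scalar_prod)
    finally show ?thesis using that by simp
  qed
  define f where "f = (\<lambda>i. sqrt (D $$ (i, i)))"
  have D_nonneg: "0 \<le> D $$ (i, i)" if "i < q" for i
    using gram [OF that that] real_scalar_prod_self_nonneg [of "M *\<^sub>v col W i"] by simp
  then have f_sq: "f i * f i = D $$ (i, i)" if "i < q" for i
    using that by (simp add: f_def)
  \<comment> \<open>Sorting indices rather than values keeps track of the column of \<open>W\<close>
    that belongs to each singular value.\<close>
  define js where "js = rev (sort_key f [0..<q])"
  have "sort (map f [0..<q]) = map f (sort_key f [0..<q])"
    by (rule properties_for_sort) auto
  then have sv: "singular_values M = map f js"
    using singular_values_eq [OF M W D S_eq] by (simp add: js_def f_def rev_map)
  have js: "distinct js" "set js = {0..<q}" by (auto simp: js_def)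
  \<comment> \<open>Positivity permits the division by \<open>f i\<close> in \<open>U\<close>; the
    indices removed contribute 0 to the norm.\<close>
  define ks where "ks = filter (\<lambda>i. 0 < f i) (take k js)"
  have ks_le: "length ks \<le> k"
    unfolding ks_def by (rule order_trans [OF length_filter_le]) simp
  have ks_dist: "distinct ks" using js by (simp add: ks_def)
  have ks_set: "i < q \<and> 0 < f i" if "i \<in> set ks" for i
    using that js by (auto simp: ks_def dest: in_set_takeD)
  have nth: "ks ! j < q \<and> 0 < f (ks ! j)" if "j < length ks" for j
    using ks_set [OF nth_mem [OF that]] .
  define V where "V = mat_of_cols q (map (col W) ks)"
  define U where "U = mat_of_cols p (map (\<lambda>i. (1 / f i) \<cdot>\<^sub>v (M *\<^sub>v col W i)) ks)"
  have V: "V \<in> carrier_mat q (length ks)" and U: "U \<in> carrier_mat p (length ks)"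
    by (auto simp: U_def V_def intro!: carrier_matI)
  have colV: "col V j = col W (ks ! j)" if "j < length ks" for j
    using that nth [OF that] W by (subst V_def, subst col_mat_of_cols) auto
  have colU: "col U j = (1 / f (ks ! j)) \<cdot>\<^sub>v (M *\<^sub>v col W (ks ! j))" if "j < length ks" for j
    using that nth [OF that] W M by (subst U_def, subst col_mat_of_cols) (auto intro!: mult_mat_vec_carrier)
  have orthV: "orthonormal_cols V"
    using W nth ks_dist
    by (intro orthonormal_colsI [OF V]) (auto simp: colV orthonormal_cols_scalar_prod nth_eq_iff_index_eq)
  have orthU: "orthonormal_cols U"
  proof (rule orthonormal_colsI [OF U])
    fix i j assume ij: "i < length ks" "j < length ks"
    note n = nth [OF ij(1)] nth [OF ij(2)]
    have "col U i \<bullet> col U j = (1 / f (ks ! i)) * ((1 / f (ks ! j)) * ((M *\<^sub>v col W (ks ! i)) \<bullet> (M *\<^sub>v col W (ks ! j))))"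
      using ij n M W by (simp add: colU)
    also have "\<dots> = (if i = j then 1 else 0)"
      using ij n ks_dist by (simp add: gram nth_eq_iff_index_eq f_sq [symmetric])
    finally show "col U i \<bullet> col U j = (if i = j then 1 else 0)" .
  qed
  have cols_term: "col U j \<bullet> (M *\<^sub>v col V j) = f (ks ! j)" if j: "j < length ks" for j
    using nth [OF j] M W by (simp add: colU [OF j] colV [OF j] gram f_sq [symmetric])
  have "ky_fan_norm k M = (\<Sum>i<k. if i < length js then f (js ! i) else 0)"
    unfolding ky_fan_norm_def
    by (rule sum.reindex_bij_witness [of _ Suc "\<lambda>i. i - 1"])
       (auto simp: singular_value_def sv Suc_le_eq)
  also have "\<dots> = (\<Sum>i<length (take k js). f (take k js ! i))"
    by (rule sum.mono_neutral_cong_right) auto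
  also have "\<dots> = sum_list (map f (take k js))"
    by (simp add: sum_list_sum_nth atLeast0LessThan)
  also have "\<dots> = sum_list (map f ks)"
    unfolding ks_def
  proof (rule sum_list_map_filter [symmetric])
    fix i assume "i \<in> set (take k js)" "\<not> 0 < f i"
    moreover from this have "i < q" using js by (auto dest: in_set_takeD)
    ultimately show "f i = 0" using D_nonneg [of i] by (auto simp: f_def)
  qed
  also have "\<dots> = (\<Sum>j<length ks. f (ks ! j))"
    by (simp add: sum_list_sum_nth atLeast0LessThan)
  also have "\<dots> = (\<Sum>j<length ks. col U j \<bullet> (M *\<^sub>v col V j))"
    by (simp add: cols_term)
  finally show thesis using that [OF ks_le U V orthU orthV] by simp
qed

lemma ky_fan_norm_le:
  assumes P: "P \<in> carrier_mat p q" "nuclear_norm_le P c" and E: "E \<in> carrier_mat p q" "op_norm_le E d"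
    and d: "0 \<le> d"
  shows "ky_fan_norm k (P + E) \<le> c + real k * d"
proof -
  have PE: "P + E \<in> carrier_mat p q" using P E by simp
  obtain r U V where r: "r \<le> k" and U: "U \<in> carrier_mat p r" "orthonormal_cols U"
    and V: "V \<in> carrier_mat q r" "orthonormal_cols V"
    and ky: "ky_fan_norm k (P + E) = (\<Sum>j<r. col U j \<bullet> ((P + E) *\<^sub>v col V j))"
    by (rule ky_fan_norm_attained [OF PE])
  have u: "col U j \<in> carrier_vec p" and v: "col V j \<in> carrier_vec q" if "j < r" for j
    using U V that by auto
  have "ky_fan_norm k (P + E) = (\<Sum>j<r. col U j \<bullet> (P *\<^sub>v col V j) + col U j \<bullet> (E *\<^sub>v col V j))"
    unfolding ky
    by (intro sum.cong refl, subst add_mult_distrib_mat_vec [OF P(1) E(1)])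
       (use u v P E in \<open>auto intro!: scalar_prod_add_distrib\<close>)
  also have "\<dots> = (\<Sum>j<r. col U j \<bullet> (P *\<^sub>v col V j)) + (\<Sum>j<r. col U j \<bullet> (E *\<^sub>v col V j))"
    by (rule sum.distrib)
  also have "\<dots> \<le> c + (\<Sum>j<r. d)"
  proof (intro add_mono sum_mono)
    show "(\<Sum>j<r. col U j \<bullet> (P *\<^sub>v col V j)) \<le> c"
      by (rule nuclear_norm_leD [OF P(2,1) U(1) V(1) U(2) V(2)])
    fix j assume "j \<in> {..<r}"
    then show "col U j \<bullet> (E *\<^sub>v col V j) \<le> d"
      using op_norm_leD [OF E(2,1) u v, of j j] U V by (simp add: vnorm_orthonormal_col)
  qed
  also have "\<dots> \<le> c + real k * d" using r d by (simp add: mult_right_mono)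
  finally show ?thesis .
qed

subsection \<open>The sketch invariant\<close>

lemma sum_row_vnorm_le_frobenius_norm:
  assumes X: "X \<in> carrier_mat n p" and Y: "Y \<in> carrier_mat n q"
  shows "(\<Sum>s<n. vnorm (row X s) * vnorm (row Y s)) \<le> frobenius_norm X * frobenius_norm Y"
proof -
  have frob: "frobenius_norm M = L2_set (\<lambda>s. vnorm (row M s)) {..<n}" if "M \<in> carrier_mat n d" for M d
    using that
    by (auto simp: frobenius_norm_def L2_set_def vnorm_def scalar_prod_def sum_nonneg power2_eq_square
        atLeast0LessThan intro!: sum.cong)
  show ?thesis
    using L2_set_mult_ineq [of "\<lambda>s. vnorm (row X s)" "\<lambda>s. vnorm (row Y s)" "{..<n}"]
    by (simp add: frob [OF X] frob [OF Y])
qed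

definition cross_product :: "real mat \<Rightarrow> real mat \<Rightarrow> nat \<Rightarrow> real mat" where
  "cross_product X Y t = mat (dim_col X) (dim_col Y) (\<lambda>(a, b). \<Sum>s<t. X $$ (s, a) * Y $$ (s, b))"

lemma cross_product_carrier [simp]: "cross_product X Y t \<in> carrier_mat (dim_col X) (dim_col Y)"
  by (simp add: cross_product_def)

lemma cross_product_full:
  assumes "dim_row X = dim_row Y"
  shows "cross_product X Y (dim_row X) = transpose_mat X * Y"
  by (rule eq_matI) (use assms in \<open>auto simp: cross_product_def scalar_prod_def atLeast0LessThan\<close>)

text \<open>\<open>D\<close> is the sum of the shrinkage amounts so far. The nuclear norm of the product is tracked instead
  of the Frobenius norms of the factors because the latter give no inductive invariant: a shrinkage
  balances the two factors, whereas later rows of \<open>X\<close> and \<open>Y\<close> may differ in scale.\<close>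

definition sketch_bound :: "nat \<Rightarrow> real mat \<Rightarrow> real mat \<Rightarrow> nat \<Rightarrow> real mat \<Rightarrow> real mat \<Rightarrow> bool" where
  "sketch_bound m X Y t A B \<longleftrightarrow> (\<exists>D \<ge> 0.
     op_norm_le (cross_product X Y t - transpose_mat A * B) D \<and>
     nuclear_norm_le (transpose_mat A * B) ((\<Sum>s<t. vnorm (row X s) * vnorm (row Y s)) - real m * D))"

definition zero_row :: "real mat \<Rightarrow> nat \<Rightarrow> bool" where
  "zero_row A i \<longleftrightarrow> (\<forall>a < dim_col A. A $$ (i, a) = 0)"

lemma set_row_carrier [simp]: "A \<in> carrier_mat n d \<Longrightarrow> set_row j v A \<in> carrier_mat n d"
  by (auto simp: set_row_def)

lemma zero_row_set_row: "\<lbrakk>zero_row A i; i \<noteq> j; i < dim_row A\<rbrakk> \<Longrightarrow> zero_row (set_row j v A) i"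
  by (auto simp: zero_row_def set_row_def)

lemma transpose_set_row_mult:
  assumes A: "A \<in> carrier_mat n p" and B: "B \<in> carrier_mat n q" and j: "j < n"
    and zero: "zero_row A j"
  shows "transpose_mat (set_row j x A) * set_row j y B
    = transpose_mat A * B + mat p q (\<lambda>(a, b). x $ a * y $ b)"
proof (rule eq_matI)
  fix a b
  assume "a < dim_row (transpose_mat A * B + mat p q (\<lambda>(a, b). x $ a * y $ b))"
    "b < dim_col (transpose_mat A * B + mat p q (\<lambda>(a, b). x $ a * y $ b))"
  then have ab: "a < p" "b < q" by auto
  have "(transpose_mat (set_row j x A) * set_row j y B) $$ (a, b)
      = (\<Sum>i\<in>{0..<n}. set_row j x A $$ (i, a) * set_row j y B $$ (i, b))"
    using A B ab by (simp add: scalar_prod_def set_row_def)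
  also have "\<dots> = (\<Sum>i\<in>{0..<n}. A $$ (i, a) * B $$ (i, b) + (if i = j then x $ a * y $ b else 0))"
    using A B ab zero by (intro sum.cong) (auto simp: set_row_def zero_row_def)
  also have "\<dots> = (transpose_mat A * B + mat p q (\<lambda>(a, b). x $ a * y $ b)) $$ (a, b)"
    using A B ab j by (simp add: sum.distrib scalar_prod_def)
  finally show "(transpose_mat (set_row j x A) * set_row j y B) $$ (a, b)
      = (transpose_mat A * B + mat p q (\<lambda>(a, b). x $ a * y $ b)) $$ (a, b)" .
qed (use A B in \<open>auto simp: set_row_def\<close>)

lemma sketch_bound_insert:
  assumes bound: "sketch_bound m X Y t A B"
    and A: "A \<in> carrier_mat n (dim_col X)" and B: "B \<in> carrier_mat n (dim_col Y)"
    and j: "j < n" "zero_row A j" and t: "t < dim_row X" "t < dim_row Y"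
  shows "sketch_bound m X Y (Suc t) (set_row j (row X t) A) (set_row j (row Y t) B)"
proof -
  obtain D where D: "0 \<le> D" "op_norm_le (cross_product X Y t - transpose_mat A * B) D"
    "nuclear_norm_le (transpose_mat A * B) ((\<Sum>s<t. vnorm (row X s) * vnorm (row Y s)) - real m * D)"
    using bound by (auto simp: sketch_bound_def)
  let ?R = "mat (dim_col X) (dim_col Y) (\<lambda>(a, b). row X t $ a * row Y t $ b)"
  have AB: "transpose_mat A * B \<in> carrier_mat (dim_col X) (dim_col Y)" using A B by simp
  note eq = transpose_set_row_mult [OF A B j, of "row X t" "row Y t"]
  have "cross_product X Y (Suc t) - (transpose_mat A * B + ?R) = cross_product X Y t - transpose_mat A * B"
    using A B t by (intro eq_matI) (auto simp: cross_product_def)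
  moreover have "nuclear_norm_le (transpose_mat A * B + ?R)
      ((\<Sum>s<t. vnorm (row X s) * vnorm (row Y s)) - real m * D + vnorm (row X t) * vnorm (row Y t))"
    by (rule nuclear_norm_le_add_rank_one [OF AB D(3)]) (use t in auto)
  ultimately show ?thesis
    using D(1,2) unfolding sketch_bound_def eq by (intro exI [of _ D]) (simp add: algebra_simps)
qed

lemma cod_shrink_sandwich:
  assumes A: "A \<in> carrier_mat (2 * m) p" and B: "B \<in> carrier_mat (2 * m) q"
    and shrink: "cod_shrink m A B A' B' S'" and m: "0 < m"
  obtains P Q S \<delta> where "P \<in> carrier_mat p (2 * m)" "orthonormal_cols P"
    "Q \<in> carrier_mat q (2 * m)" "orthonormal_cols Q"
    "S \<in> carrier_mat (2 * m) (2 * m)" "diagonal_mat S"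
    "\<forall>i < 2 * m. 0 \<le> S $$ (i, i)" "0 \<le> \<delta>" "\<forall>i < m. \<delta> \<le> S $$ (i, i)"
    "S' \<in> carrier_mat (2 * m) (2 * m)" "diagonal_mat S'"
    "\<forall>i < 2 * m. S' $$ (i, i) = max (S $$ (i, i) - \<delta>) 0"
    "transpose_mat A * B = P * S * transpose_mat Q"
    "A' = map_mat sqrt S' * transpose_mat P" "B' = map_mat sqrt S' * transpose_mat Q"
proof -
  let ?n = "2 * m"
  obtain Qx Rx Qy Ry U S V where qrA: "reduced_QR (transpose_mat A) Qx Rx"
    and qrB: "reduced_QR (transpose_mat B) Qy Ry" and svd: "is_SVD (Rx * transpose_mat Ry) U S V"
    and S': "S' = map_mat (\<lambda>s. max s 0) (S - singular_value m (Rx * transpose_mat Ry) \<cdot>\<^sub>m 1\<^sub>m ?n)"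
    and A': "A' = map_mat sqrt S' * transpose_mat U * transpose_mat Qx"
    and B': "B' = map_mat sqrt S' * transpose_mat V * transpose_mat Qy"
    using shrink by (auto simp: cod_shrink_def Let_def)
  define \<delta> where "\<delta> = singular_value m (Rx * transpose_mat Ry)"
  have Qx: "Qx \<in> carrier_mat p ?n" "orthonormal_cols Qx" and Rx: "Rx \<in> carrier_mat ?n ?n"
    and At: "transpose_mat A = Qx * Rx"
    and Qy: "Qy \<in> carrier_mat q ?n" "orthonormal_cols Qy" and Ry: "Ry \<in> carrier_mat ?n ?n"
    and Bt: "transpose_mat B = Qy * Ry"
    using qrA qrB A B by (auto simp: reduced_QR_def)
  have R: "Rx * transpose_mat Ry \<in> carrier_mat ?n ?n" using Rx Ry by simp
  have U: "U \<in> carrier_mat ?n ?n" "orthonormal_cols U" and V: "V \<in> carrier_mat ?n ?n" "orthonormal_cols V"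
    and S: "S \<in> carrier_mat ?n ?n" "diagonal_mat S" and pos: "\<And>i. i < ?n \<Longrightarrow> 0 \<le> S $$ (i, i)"
    and mono: "\<And>i j. i \<le> j \<Longrightarrow> j < ?n \<Longrightarrow> S $$ (j, j) \<le> S $$ (i, i)"
    and svd_eq: "Rx * transpose_mat Ry = U * S * transpose_mat V"
    using svd by (auto simp: is_SVD_def Let_def carrier_matD [OF Rx] carrier_matD [OF Ry] simp del: assoc_mult_mat)
  have \<delta>: "\<delta> = S $$ (m - 1, m - 1)"
    unfolding \<delta>_def using m by (intro singular_value_SVD [OF R svd]) auto
  show thesis
  proof (rule that)
    show "Qx * U \<in> carrier_mat p ?n" "Qy * V \<in> carrier_mat q ?n" using Qx Qy U V by auto
    show "orthonormal_cols (Qx * U)" by (rule orthonormal_cols_mult [OF Qx U])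
    show "orthonormal_cols (Qy * V)" by (rule orthonormal_cols_mult [OF Qy V])
    show "S \<in> carrier_mat ?n ?n" "diagonal_mat S" by (fact S)+
    show "\<forall>i < ?n. 0 \<le> S $$ (i, i)" using pos by blast
    show "0 \<le> \<delta>" using m by (simp add: \<delta> pos)
    show "\<forall>i < m. \<delta> \<le> S $$ (i, i)" using m unfolding \<delta> by (intro allI impI mono) auto
    show "S' \<in> carrier_mat ?n ?n" using S by (auto simp: S')
    show "diagonal_mat S'" using S by (auto simp: S' diagonal_mat_def)
    show "\<forall>i < ?n. S' $$ (i, i) = max (S $$ (i, i) - \<delta>) 0"
      using S by (simp add: S' \<delta>_def)
    have "B = transpose_mat (Qy * Ry)" by (simp add: Bt [symmetric])
    then have "transpose_mat A * B = Qx * Rx * (transpose_mat Ry * transpose_mat Qy)"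
      using Qy Ry by (simp add: At transpose_mult [of _ q ?n _ ?n])
    also have "\<dots> = Qx * (Rx * transpose_mat Ry) * transpose_mat Qy"
      using Qx Rx Ry Qy by (simp add: assoc_mult_mat [of _ p ?n _ ?n _ ?n] assoc_mult_mat [of _ p ?n _ ?n _ q]
          assoc_mult_mat [of _ ?n ?n _ ?n _ q])
    also have "\<dots> = Qx * U * S * transpose_mat (Qy * V)"
      unfolding svd_eq using Qx Qy U V S
      by (simp add: transpose_mult [of _ q ?n _ ?n] assoc_mult_mat [of _ p ?n _ ?n _ ?n]
          assoc_mult_mat [of _ p ?n _ ?n _ q] assoc_mult_mat [of _ ?n ?n _ ?n _ q] assoc_mult_mat [of _ ?n ?n _ ?n _ ?n])
    finally show "transpose_mat A * B = Qx * U * S * transpose_mat (Qy * V)" .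
    have S'c: "map_mat sqrt S' \<in> carrier_mat ?n ?n" using S by (auto simp: S')
    show "A' = map_mat sqrt S' * transpose_mat (Qx * U)"
      unfolding A' using S'c Qx U
      by (simp add: transpose_mult [of _ p ?n _ ?n] assoc_mult_mat [of _ ?n ?n _ ?n _ p])
    show "B' = map_mat sqrt S' * transpose_mat (Qy * V)"
      unfolding B' using S'c Qy V
      by (simp add: transpose_mult [of _ q ?n _ ?n] assoc_mult_mat [of _ ?n ?n _ ?n _ q])
  qed
qed

lemma sketch_bound_shrink:
  assumes bound: "sketch_bound m X Y t A B"
    and A: "A \<in> carrier_mat (2 * m) (dim_col X)" and B: "B \<in> carrier_mat (2 * m) (dim_col Y)"
    and shrink: "cod_shrink m A B A' B' S'" and m: "0 < m"
  shows "A' \<in> carrier_mat (2 * m) (dim_col X)" and "B' \<in> carrier_mat (2 * m) (dim_col Y)"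
    and "\<And>i. \<lbrakk>i < 2 * m; S' $$ (i, i) = 0\<rbrakk> \<Longrightarrow> zero_row A' i"
    and "sketch_bound m X Y t A' B'"
proof -
  let ?n = "2 * m" and ?p = "dim_col X" and ?q = "dim_col Y"
  obtain P Q S \<delta> where P: "P \<in> carrier_mat ?p ?n" "orthonormal_cols P"
    and Q: "Q \<in> carrier_mat ?q ?n" "orthonormal_cols Q"
    and S: "S \<in> carrier_mat ?n ?n" "diagonal_mat S"
    and pos: "\<forall>i < ?n. 0 \<le> S $$ (i, i)"
    and \<delta>: "0 \<le> \<delta>" "\<forall>i < m. \<delta> \<le> S $$ (i, i)"
    and S': "S' \<in> carrier_mat ?n ?n" "diagonal_mat S'"
    and S'_eq: "\<forall>i < ?n. S' $$ (i, i) = max (S $$ (i, i) - \<delta>) 0"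
    and AB: "transpose_mat A * B = P * S * transpose_mat Q"
    and A': "A' = map_mat sqrt S' * transpose_mat P" and B': "B' = map_mat sqrt S' * transpose_mat Q"
    by (rule cod_shrink_sandwich [OF A B shrink m])
  let ?H = "map_mat sqrt S'"
  have H: "?H \<in> carrier_mat ?n ?n" "diagonal_mat ?H" using S' by (auto simp: diagonal_mat_def)
  show A'c: "A' \<in> carrier_mat ?n ?p" and B'c: "B' \<in> carrier_mat ?n ?q"
    using H P Q by (auto simp: A' B')
  show "zero_row A' i" if "i < ?n" "S' $$ (i, i) = 0" for i
    unfolding zero_row_def
  proof (intro allI impI)
    fix a assume "a < dim_col A'"
    then have "A' $$ (i, a) = ?H $$ (i, i) * transpose_mat P $$ (i, a)"
      unfolding A' using P that(1) by (intro diagonal_mult_mat_index [OF H]) auto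
    then show "A' $$ (i, a) = 0" using that S' by simp
  qed
  have HH: "?H * ?H = S'"
  proof (rule eq_matI)
    fix i j assume "i < dim_row S'" "j < dim_col S'"
    then have ij: "i < ?n" "j < ?n" using S' by auto
    have "(?H * ?H) $$ (i, j) = ?H $$ (i, i) * ?H $$ (i, j)"
      by (rule diagonal_mult_mat_index [OF H H(1) ij])
    then show "(?H * ?H) $$ (i, j) = S' $$ (i, j)"
      using ij S' by (cases "i = j") (auto simp: diagonal_mat_def S'_eq)
  qed (use S' in auto)
  have Pt: "transpose_mat P \<in> carrier_mat ?n ?p" and Qt: "transpose_mat Q \<in> carrier_mat ?n ?q"
    using P Q by auto
  have "transpose_mat A' = P * ?H"
    by (simp only: A' transpose_mult [OF H(1) Pt] transpose_transpose transpose_diagonal_mat [OF H])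
  then have "transpose_mat A' * B' = P * ?H * (?H * transpose_mat Q)" by (simp only: B')
  also have "\<dots> = P * (?H * ?H) * transpose_mat Q"
    by (simp only: assoc_mult_mat [OF P(1) H(1) mult_carrier_mat [OF H(1) Qt]]
        assoc_mult_mat [OF P(1) mult_carrier_mat [OF H(1,1)] Qt] assoc_mult_mat [OF H(1,1) Qt])
  finally have A'B': "transpose_mat A' * B' = P * S' * transpose_mat Q" by (simp only: HH)
  obtain D where D: "0 \<le> D" "op_norm_le (cross_product X Y t - transpose_mat A * B) D"
    "nuclear_norm_le (transpose_mat A * B) ((\<Sum>s<t. vnorm (row X s) * vnorm (row Y s)) - real m * D)"
    using bound by (auto simp: sketch_bound_def)
  have "op_norm_le (P * (S - S') * transpose_mat Q) \<delta>"
  proof (rule op_norm_le_diagonal_sandwich [OF P Q])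
    show "S - S' \<in> carrier_mat ?n ?n" by (rule minus_carrier_mat [OF S'(1)])
    show "diagonal_mat (S - S')" using S S' by (auto simp: diagonal_mat_def)
    show "\<bar>(S - S') $$ (i, i)\<bar> \<le> \<delta>" if "i < ?n" for i
      using that S S' \<delta>(1) pos by (auto simp: S'_eq)
  qed (fact \<delta>)
  moreover have "P * (S - S') * transpose_mat Q = transpose_mat A * B - transpose_mat A' * B'"
    unfolding AB A'B' mult_minus_distrib_mat [OF P(1) S(1) S'(1)]
    by (rule minus_mult_distrib_mat) (use P(1) S(1) S'(1) Qt in auto)
  ultimately have "op_norm_le ((cross_product X Y t - transpose_mat A * B) +
      (transpose_mat A * B - transpose_mat A' * B')) (D + \<delta>)"
    using D(2) A B A'c B'c by (intro op_norm_le_add [of _ _ _ _ ?p ?q]) auto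
  moreover have "(cross_product X Y t - transpose_mat A * B) + (transpose_mat A * B - transpose_mat A' * B')
      = cross_product X Y t - transpose_mat A' * B'"
    using A B A'c B'c by (intro eq_matI) (auto simp: cross_product_def)
  ultimately have op: "op_norm_le (cross_product X Y t - transpose_mat A' * B') (D + \<delta>)" by simp
  have "(\<Sum>i<?n. if i < m then \<delta> else 0) \<le> (\<Sum>i<?n. S $$ (i, i) - S' $$ (i, i))"
    using \<delta> pos by (intro sum_mono) (auto simp: S'_eq max_def)
  also have "(\<Sum>i<?n. if i < m then \<delta> else 0) = (\<Sum>i<m. \<delta>)"
    by (rule sum.mono_neutral_cong_right) auto
  finally have "real m * \<delta> \<le> (\<Sum>i<?n. S $$ (i, i)) - (\<Sum>i<?n. S' $$ (i, i))"
    by (simp add: sum_subtractf)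
  moreover have "(\<Sum>i<?n. S $$ (i, i)) \<le> (\<Sum>s<t. vnorm (row X s) * vnorm (row Y s)) - real m * D"
    by (rule sum_diagonal_le_nuclear_norm [OF P Q S]) (use D(3) in \<open>simp only: AB\<close>)
  ultimately have "(\<Sum>i<?n. S' $$ (i, i)) \<le> (\<Sum>s<t. vnorm (row X s) * vnorm (row Y s)) - real m * (D + \<delta>)"
    by (simp add: algebra_simps)
  moreover have "nuclear_norm_le (transpose_mat A' * B') (\<Sum>i<?n. S' $$ (i, i))"
    unfolding A'B' by (rule nuclear_norm_le_diagonal_sandwich [OF P Q S']) (simp add: S'_eq)
  ultimately have "nuclear_norm_le (transpose_mat A' * B')
      ((\<Sum>s<t. vnorm (row X s) * vnorm (row Y s)) - real m * (D + \<delta>))"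
    by (rule nuclear_norm_le_mono [rotated])
  with op D(1) \<delta>(1) show "sketch_bound m X Y t A' B'"
    unfolding sketch_bound_def by (intro exI [of _ "D + \<delta>"]) auto
qed

lemma cod_run_sketch_bound:
  assumes run: "cod_run m X Y t A B occ" and rows: "dim_row X = dim_row Y" and m: "0 < m"
  shows "A \<in> carrier_mat (2 * m) (dim_col X) \<and> B \<in> carrier_mat (2 * m) (dim_col Y) \<and>
    (\<forall>i < 2 * m. i \<notin> occ \<longrightarrow> zero_row A i) \<and> sketch_bound m X Y t A B"
  using run
proof (induction rule: cod_run.induct)
  case init
  have "cross_product X Y 0 = 0\<^sub>m (dim_col X) (dim_col Y)"
    by (rule eq_matI) (auto simp: cross_product_def)
  moreover have "(0\<^sub>m p q - 0\<^sub>m p q) *\<^sub>v v = 0\<^sub>v p" if "v \<in> carrier_vec q" for p q and v :: "real vec"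
    using that by (intro eq_vecI) (auto simp: scalar_prod_def)
  moreover have "0\<^sub>m p q *\<^sub>v v = 0\<^sub>v p" if "v \<in> carrier_vec q" for p q and v :: "real vec"
    using that by (intro eq_vecI) auto
  ultimately have "sketch_bound m X Y 0 (0\<^sub>m (2 * m) (dim_col X)) (0\<^sub>m (2 * m) (dim_col Y))"
    unfolding sketch_bound_def
    by (intro exI [of _ 0]) (auto simp: op_norm_le_def nuclear_norm_le_def)
  then show ?case by (auto simp: zero_row_def)
next
  case (insert t A B occ j)
  then show ?case using rows
    by (auto simp: zero_row_set_row intro!: sketch_bound_insert [of m X Y t A B "2 * m"])
next
  case (insert_shrink t A B occ j A' B' S')
  have "sketch_bound m X Y (Suc t) (set_row j (row X t) A) (set_row j (row Y t) B)"
    using insert_shrink rows by (auto intro!: sketch_bound_insert [of m X Y t A B "2 * m"])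
  from sketch_bound_shrink [OF this _ _ insert_shrink.hyps(6) m] insert_shrink.IH show ?case
    by auto
qed

theorem theorem1:
  fixes X Y A B :: "real mat" and m n dx dy k :: nat
  assumes "0 < m" and "0 < n" and "0 < dx" and "0 < dy"
    and "2 * m \<le> min dx dy"
    and "X \<in> carrier_mat n dx" and "Y \<in> carrier_mat n dy"
    and "cod_output m X Y A B"
    and "k < m"
  shows "spectral_norm (transpose_mat X * Y - transpose_mat A * B)
         \<le> 1 / (real m - real k) *
            (frobenius_norm X * frobenius_norm Y - ky_fan_norm k (transpose_mat X * Y))"
proof -
  let ?G = "transpose_mat X * Y" and ?P = "transpose_mat A * B"
  have G: "?G \<in> carrier_mat dx dy" using assms by simp
  have dims: "dim_row X = n" "dim_row Y = n" "dim_col X = dx" "dim_col Y = dy"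
    using assms by auto
  obtain occ where "cod_run m X Y n A B occ"
    using assms(8) dims by (auto simp: cod_output_def)
  from cod_run_sketch_bound [OF this _ assms(1)] have A: "A \<in> carrier_mat (2 * m) dx"
    and B: "B \<in> carrier_mat (2 * m) dy" and bound: "sketch_bound m X Y n A B"
    by (auto simp: dims)
  have cross: "cross_product X Y n = ?G" using cross_product_full [of X Y] dims by simp
  obtain D where D: "0 \<le> D" "op_norm_le (?G - ?P) D"
    "nuclear_norm_le ?P ((\<Sum>s<n. vnorm (row X s) * vnorm (row Y s)) - real m * D)"
    using bound by (auto simp: sketch_bound_def cross)
  have P: "?P \<in> carrier_mat dx dy" using A B by simp
  then have E: "?G - ?P \<in> carrier_mat dx dy" by (rule minus_carrier_mat)
  have "ky_fan_norm k (?P + (?G - ?P))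
      \<le> ((\<Sum>s<n. vnorm (row X s) * vnorm (row Y s)) - real m * D) + real k * D"
    by (rule ky_fan_norm_le [OF P D(3) E D(2,1)])
  moreover have "?P + (?G - ?P) = ?G" using A B assms(6,7) by (intro eq_matI) auto
  ultimately have "(real m - real k) * D \<le> frobenius_norm X * frobenius_norm Y - ky_fan_norm k ?G"
    using sum_row_vnorm_le_frobenius_norm [OF assms(6,7)] by (simp add: algebra_simps)
  then have "D \<le> 1 / (real m - real k) * (frobenius_norm X * frobenius_norm Y - ky_fan_norm k ?G)"
    using \<open>k < m\<close> by (simp add: field_simps)
  moreover have "spectral_norm (?G - ?P) \<le> D" by (rule spectral_norm_le [OF E D(2,1)])
  ultimately show ?thesis by linarith
qed

end
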